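(* Let $G$ be a $(q+1)$-regular diagram with $L_2^0(G)\ne0$, and let $G'$ be a finite connected subgraph of $G$ with $n\ge2$ vertices such that every edge of $G$ joining two vertices of $G'$ is an edge of $G'$, with weights inherited from $G$. Let $d_1=\min_{v\in V(G')}\deg_{G'}(v)$, and let $0=\gamma_1\le\gamma_2\le\cdots\le\gamma_n$ be the eigenvalues of the weighted Laplacian $\Delta$ of $G'$. Then $$\gamma_2\ge d_1-M,\qquad \gamma_{n-1}\le (q+1)+M,\qquad \gamma_n\le 2(q+1).$$
   Context: A graph (Serre's sense) has vertices $V(G)$, oriented edges $E(G)$, maps $e\mapsto(o(e),t(e))$, $e\mapsto\bar e$ with $\bar{\bar e}=e\ne\bar e$, $t(\bar e)=o(e)$; it is connected, has no loops, each vertex is the terminus of finitely many edges; multiple edges allowed. Weights $w:E(G)\to\mathbb{Z}_{>0}$ with $w(\bar e)=w(e)$, $w:V(G)\to\mathbb{Z}_{>0}$. $G$ is a $(q+1)$-regular diagram if: (i) $V(G)=O\sqcup I$ with every edge joining $O$ and $I$; (ii) $w(e)\mid w(t(e))$; (iii) $\sum_{t(e)=v}w(v)/w(e)=q+1$ for all $v$; (iv) $\sum_v w(v)^{-1}<\infty$. $L_2(G)$: functions $V(G)\to\mathbb{C}$ with $\langle f,g\rangle=\sum_vf(v)\overline{g(v)}w(v)^{-1}$; adjacency $(\delta f)(v)=\sum_{t(e)=v}\frac{w(v)}{w(e)}f(o(e))$; $L_2^0(G)=\{f:\sum_{v\in I}f(v)w(v)^{-1}=\sum_{v\in O}f(v)w(v)^{-1}=0\}$;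 $M=\sup\{\langle\delta f,f\rangle:f\in L_2^0(G),\|f\|=1\}$. The degree of $v\in V(G')$ is $\deg_{G'}(v)=\sum_{e\in E(G'),t(e)=v}w(v)/w(e)$. The weighted Laplacian of $G'$ is the operator on functions on $V(G')$ (equivalently on $C_0(G',\mathbb{C})$) given by $\Delta(v)=\sum_{e\in E(G'),t(e)=v}\frac{w(v)}{w(e)}(v-o(e))$; it is Hermitian and nonnegative for the inner product $\sum_{v\in V(G')}f(v)\overline{g(v)}w(v)^{-1}$, with $0$ a simple eigenvalue. *)

theory Defs
  imports
    "HOL-Analysis.Analysis"
    "Graph_Theory.Graph_Theory"
    "Jordan_Normal_Form.Char_Poly"
begin

text \<open>
  In a graph in the sense of Serre, the oriented edge \<open>e\<close> goes from \<open>o(e) = tail G e\<close> to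
  \<open>t(e) = head G e\<close>, and \<open>arev\<close> is the reversal of edges. That \<open>arev\<close> fixes everything which is not
  an edge of \<open>G\<close> is a convention of \<^locale>\<open>bidirected_digraph\<close>, without mathematical content.
\<close>

locale serre_graph = bidirected_digraph G arev + loopfree_digraph G
  for G :: "('v, 'e) pre_digraph" and arev :: "'e \<Rightarrow> 'e" +
  assumes connected_graph: "Digraph_Component.connected G"
    and locally_finite: "v \<in> verts G \<Longrightarrow> finite (in_arcs G v)"

definition weighted_degree ::
    "('v, 'e) pre_digraph \<Rightarrow> ('e \<Rightarrow> nat) \<Rightarrow> ('v \<Rightarrow> nat) \<Rightarrow> 'v \<Rightarrow> real" where
  "weighted_degree G we wv v = (\<Sum>e\<in>in_arcs G v. real (wv v) / real (we e))"

locale regular_diagram = serre_graph G arev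
  for G :: "('v, 'e) pre_digraph" and arev :: "'e \<Rightarrow> 'e" +
  fixes we :: "'e \<Rightarrow> nat" and wv :: "'v \<Rightarrow> nat"
    and Vo Vi :: "'v set" and q :: nat
  assumes edge_weight_pos: "e \<in> arcs G \<Longrightarrow> we e > 0"
    and edge_weight_arev: "e \<in> arcs G \<Longrightarrow> we (arev e) = we e"
    and vertex_weight_pos: "v \<in> verts G \<Longrightarrow> wv v > 0"
    and bipartition: "verts G = Vo \<union> Vi" "Vo \<inter> Vi = {}"
    and edges_bipartite: "e \<in> arcs G \<Longrightarrow>
          (tail G e \<in> Vo \<and> head G e \<in> Vi) \<or> (tail G e \<in> Vi \<and> head G e \<in> Vo)"
    and weight_dvd: "e \<in> arcs G \<Longrightarrow> we e dvd wv (head G e)"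
    and regular: "v \<in> verts G \<Longrightarrow> weighted_degree G we wv v = real q + 1"
    and finite_measure: "(\<lambda>v. 1 / real (wv v)) summable_on verts G"

text \<open>
  Functions on the vertices of \<open>G\<close> are functions on the whole vertex type that vanish outside
  \<open>verts G\<close>; the operators below preserve this.
\<close>

definition L2 :: "('v, 'e) pre_digraph \<Rightarrow> ('v \<Rightarrow> nat) \<Rightarrow> ('v \<Rightarrow> complex) set" where
  "L2 G wv = {f. (\<forall>v. v \<notin> verts G \<longrightarrow> f v = 0) \<and>
                 (\<lambda>v. (cmod (f v))\<^sup>2 / real (wv v)) summable_on verts G}"

definition L2_inner ::
    "('v, 'e) pre_digraph \<Rightarrow> ('v \<Rightarrow> nat) \<Rightarrow> ('v \<Rightarrow> complex) \<Rightarrow> ('v \<Rightarrow> complex) \<Rightarrow> complex" where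
  "L2_inner G wv f g = (\<Sum>\<^sub>\<infinity>v\<in>verts G. f v * cnj (g v) / of_nat (wv v))"

definition L2_norm :: "('v, 'e) pre_digraph \<Rightarrow> ('v \<Rightarrow> nat) \<Rightarrow> ('v \<Rightarrow> complex) \<Rightarrow> real" where
  "L2_norm G wv f = sqrt (Re (L2_inner G wv f f))"

definition L2_0 ::
    "('v, 'e) pre_digraph \<Rightarrow> ('v \<Rightarrow> nat) \<Rightarrow> 'v set \<Rightarrow> 'v set \<Rightarrow> ('v \<Rightarrow> complex) set" where
  "L2_0 G wv Vo Vi = {f \<in> L2 G wv. (\<Sum>\<^sub>\<infinity>v\<in>Vi. f v / of_nat (wv v)) = 0 \<and>
                                   (\<Sum>\<^sub>\<infinity>v\<in>Vo. f v / of_nat (wv v)) = 0}"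

definition adjacency ::
    "('v, 'e) pre_digraph \<Rightarrow> ('e \<Rightarrow> nat) \<Rightarrow> ('v \<Rightarrow> nat) \<Rightarrow> ('v \<Rightarrow> complex) \<Rightarrow> 'v \<Rightarrow> complex" where
  "adjacency G we wv f v =
     (\<Sum>e\<in>in_arcs G v. of_nat (wv v) / of_nat (we e) * f (tail G e))"

text \<open>
  In a regular diagram the adjacency operator is self-adjoint and bounded on \<^const>\<open>L2\<close>, so
  \<open>\<langle>\<delta>f, f\<rangle>\<close> is real and the set below is bounded; it is nonempty if \<open>L2_0 \<noteq> 0\<close>.
\<close>

definition diagram_M ::
    "('v, 'e) pre_digraph \<Rightarrow> ('e \<Rightarrow> nat) \<Rightarrow> ('v \<Rightarrow> nat) \<Rightarrow> 'v set \<Rightarrow> 'v set \<Rightarrow> real" where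
  "diagram_M G we wv Vo Vi =
     Sup {Re (L2_inner G wv (adjacency G we wv f) f) | f.
            f \<in> L2_0 G wv Vo Vi \<and> L2_norm G wv f = 1}"

text \<open>
  The Laplacian as an operator on functions, Hermitian for \<^const>\<open>L2_inner\<close>. On chains, where
  \<open>\<Delta>(v)\<close> is the sum of the \<open>w(v)/w(e) (v - o(e))\<close>, its matrix with respect to the basis of vertices is
  the transpose of the matrix of the operator below with respect to the indicator functions.
\<close>

definition weighted_laplacian ::
    "('v, 'e) pre_digraph \<Rightarrow> ('e \<Rightarrow> nat) \<Rightarrow> ('v \<Rightarrow> nat) \<Rightarrow> ('v \<Rightarrow> complex) \<Rightarrow> 'v \<Rightarrow> complex" where
  "weighted_laplacian H we wv f v =
     (\<Sum>e\<in>in_arcs H v. of_nat (wv v) / of_nat (we e) * (f v - f (tail H e)))"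

definition operator_mat :: "'v list \<Rightarrow> (('v \<Rightarrow> complex) \<Rightarrow> 'v \<Rightarrow> complex) \<Rightarrow> complex mat" where
  "operator_mat vs T = mat (length vs) (length vs)
     (\<lambda>(i, j). T (\<lambda>v. if v = vs ! j then 1 else 0) (vs ! i))"

text \<open>
  \<open>\<gamma> 1 \<le> \<dots> \<le> \<gamma> (card A)\<close> are the eigenvalues, with multiplicity, of the linear operator \<open>T\<close> on functions
  on the finite set \<open>A\<close>. The characteristic polynomial does not depend on the enumeration \<open>vs\<close> of \<open>A\<close>.
\<close>

definition ordered_eigenvalues ::
    "'v set \<Rightarrow> (('v \<Rightarrow> complex) \<Rightarrow> 'v \<Rightarrow> complex) \<Rightarrow> (nat \<Rightarrow> real) \<Rightarrow> bool" where
  "ordered_eigenvalues A T \<gamma> \<longleftrightarrow>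
     mono_on {1..card A} \<gamma> \<and>
     (\<exists>vs. distinct vs \<and> set vs = A \<and>
        char_poly (operator_mat vs T) = (\<Prod>i = 1..card A. [:- complex_of_real (\<gamma> i), 1:]))"

end

theory Submission
  imports Defs "Jordan_Normal_Form.Schur_Decomposition"
begin

text \<open>
  On functions supported on the finite subgraph, the Laplacian is the degree minus the adjacency
  operator \<open>\<delta>\<close> of the whole diagram, so its Rayleigh quotient is controlled by the numbers
  \<open>\<langle>\<delta>f, f\<rangle>\<close>. Let \<open>s\<close> be \<open>1\<close> on \<open>O\<close> and \<open>-1\<close> on \<open>I\<close>. The constant \<open>1\<close> and \<open>s\<close> are orthogonal
  eigenfunctions of \<open>\<delta>\<close> for \<open>q + 1\<close> and \<open>-(q + 1)\<close>, and \<open>L\<^sub>2\<^sup>0\<close> is the orthogonal complement of both.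
  If only \<open>f \<bottom> 1\<close> is known, removing the component along \<open>s\<close> does not decrease \<open>\<langle>\<delta>f, f\<rangle>\<close>, so
  \<open>\<langle>\<delta>f, f\<rangle> \<le> M \<parallel>f\<parallel>\<^sup>2\<close>; multiplication by \<open>s\<close> anticommutes with \<open>\<delta>\<close>, so \<open>f \<bottom> s\<close> gives
  \<open>\<langle>\<delta>f, f\<rangle> \<ge> - M \<parallel>f\<parallel>\<^sup>2\<close>. The plane spanned by eigenfunctions for \<open>\<gamma>\<^sub>1, \<gamma>\<^sub>2\<close> contains some
  \<open>f \<noteq> 0\<close> orthogonal to \<open>1\<close>, and the one for \<open>\<gamma>\<^sub>n\<^sub>-\<^sub>1, \<gamma>\<^sub>n\<close> contains some \<open>f \<noteq> 0\<close> orthogonal to \<open>s\<close>;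
  comparing Rayleigh quotients gives the first two bounds. The third follows from
  \<open>\<bar>\<langle>\<delta>f, f\<rangle>\<bar> \<le> (q + 1) \<parallel>f\<parallel>\<^sup>2\<close>.
\<close>

unbundle no vec_syntax

section \<open>Eigenfunctions of self-adjoint operators on a finite set\<close>

text \<open>A Schur form \<open>B\<close> can carry the eigenvalues on its diagonal in any
  prescribed order, so any two may come first. The first two unit vectors then span a plane
  invariant under \<open>B\<close>, and \<open>P\<close> carries it to a plane invariant under
  \<open>A\<close>.\<close>

lemma triangular_pair:
  fixes A :: "complex mat"
  assumes A: "A \<in> carrier_mat n n"
    and cp: "char_poly A = (\<Prod>c\<leftarrow>a # b # es. [:- c, 1:])"
  obtains p1 p2 c where "p1 \<in> carrier_vec n" "p2 \<in> carrier_vec n"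
    "A *\<^sub>v p1 = a \<cdot>\<^sub>v p1" "A *\<^sub>v p2 = c \<cdot>\<^sub>v p1 + b \<cdot>\<^sub>v p2"
    "\<And>x y. x \<cdot>\<^sub>v p1 + y \<cdot>\<^sub>v p2 = 0\<^sub>v n \<Longrightarrow> x = 0 \<and> y = 0"
proof -
  obtain B P Q where "schur_decomposition A (a # b # es) = (B, P, Q)"
    by (rule prod_cases3)
  from schur_decomposition[OF A cp this]
  have sim: "similar_mat_wit A B P Q" and ut: "upper_triangular B"
    and diag: "diag_mat B = a # b # es" by auto
  from sim A have B: "B \<in> carrier_mat n n" and P: "P \<in> carrier_mat n n" and Q: "Q \<in> carrier_mat n n"
    and QP: "Q * P = 1\<^sub>m n" and AB: "A = P * B * Q"
    unfolding similar_mat_wit_def Let_def by auto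
  from diag B have n: "n = Suc (Suc (length es))"
    by (auto simp: diag_mat_def dest: arg_cong[where f = length])
  have B00: "B $$ (0, 0) = a" and B11: "B $$ (1, 1) = b"
  proof -
    have "diag_mat B ! i = B $$ (i, i)" if "i < n" for i
      using that B unfolding diag_mat_def by simp
    from this[of 0] this[of 1] show "B $$ (0, 0) = a" "B $$ (1, 1) = b"
      using n by (simp_all add: diag)
  qed
  let ?e0 = "unit_vec n 0 :: complex vec" and ?e1 = "unit_vec n 1 :: complex vec"
  define c where "c = B $$ (0, 1)"
  have zero: "B $$ (i, j) = 0" if "j < i" "i < n" for i j
    using ut B that unfolding upper_triangular_def by auto
  have e: "?e0 \<in> carrier_vec n" "?e1 \<in> carrier_vec n" by auto
  have Be0: "B *\<^sub>v ?e0 = a \<cdot>\<^sub>v ?e0"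
  proof (rule eq_vecI)
    fix i assume "i < dim_vec (a \<cdot>\<^sub>v ?e0)"
    then have i: "i < n" by simp
    have "(B *\<^sub>v ?e0) $ i = B $$ (i, 0)" using B i n by simp
    then show "(B *\<^sub>v ?e0) $ i = (a \<cdot>\<^sub>v ?e0) $ i"
      using i n B00 zero[of 0 i] by (cases "i = 0") auto
  qed (use B in auto)
  have Be1: "B *\<^sub>v ?e1 = c \<cdot>\<^sub>v ?e0 + b \<cdot>\<^sub>v ?e1"
  proof (rule eq_vecI)
    fix i assume "i < dim_vec (c \<cdot>\<^sub>v ?e0 + b \<cdot>\<^sub>v ?e1)"
    then have i: "i < n" by simp
    have "(B *\<^sub>v ?e1) $ i = B $$ (i, 1)" using B i n by simp
    then show "(B *\<^sub>v ?e1) $ i = (c \<cdot>\<^sub>v ?e0 + b \<cdot>\<^sub>v ?e1) $ i"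
      using i n B11 zero[of 1 i] c_def
      by (cases "i = 0"; cases "i = 1") auto
  qed (use B in auto)
  have AP: "A *\<^sub>v (P *\<^sub>v v) = P *\<^sub>v (B *\<^sub>v v)" if v: "v \<in> carrier_vec n" for v
  proof -
    have "A * P = P * B"
      using P B Q QP unfolding AB by (simp add: assoc_mult_mat[of _ n n _ n _ n])
    then show ?thesis
      using A B P v by (metis assoc_mult_mat_vec)
  qed
  show ?thesis
  proof
    show "P *\<^sub>v ?e0 \<in> carrier_vec n" "P *\<^sub>v ?e1 \<in> carrier_vec n"
      using P by auto
    show "A *\<^sub>v (P *\<^sub>v ?e0) = a \<cdot>\<^sub>v (P *\<^sub>v ?e0)"
      using P by (simp add: AP Be0 mult_mat_vec)
    show "A *\<^sub>v (P *\<^sub>v ?e1) = c \<cdot>\<^sub>v (P *\<^sub>v ?e0) + b \<cdot>\<^sub>v (P *\<^sub>v ?e1)"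
      unfolding AP[OF e(2)] Be1 using P by (simp add: mult_mat_vec[of _ n n] mult_add_distrib_mat_vec[of _ n n])
    fix x y
    assume "x \<cdot>\<^sub>v (P *\<^sub>v ?e0) + y \<cdot>\<^sub>v (P *\<^sub>v ?e1) = 0\<^sub>v n"
    then have "P *\<^sub>v (x \<cdot>\<^sub>v ?e0 + y \<cdot>\<^sub>v ?e1) = 0\<^sub>v n"
      using P by (simp add: mult_mat_vec[of _ n n] mult_add_distrib_mat_vec[of _ n n])
    then have "Q *\<^sub>v (P *\<^sub>v (x \<cdot>\<^sub>v ?e0 + y \<cdot>\<^sub>v ?e1)) = 0\<^sub>v n"
      using Q by auto
    moreover have "Q *\<^sub>v (P *\<^sub>v (x \<cdot>\<^sub>v ?e0 + y \<cdot>\<^sub>v ?e1)) = x \<cdot>\<^sub>v ?e0 + y \<cdot>\<^sub>v ?e1"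
      using P Q by (simp flip: assoc_mult_mat_vec[of _ n n _ n] add: QP)
    ultimately have eq: "x \<cdot>\<^sub>v ?e0 + y \<cdot>\<^sub>v ?e1 = 0\<^sub>v n" by simp
    have "(x \<cdot>\<^sub>v ?e0 + y \<cdot>\<^sub>v ?e1) $ 0 = 0" "(x \<cdot>\<^sub>v ?e0 + y \<cdot>\<^sub>v ?e1) $ 1 = 0"
      unfolding eq using n by auto
    then show "x = 0 \<and> y = 0" using n by simp
  qed
qed

section \<open>The weighted inner product on a finite set\<close>

definition fin_inner :: "'v set \<Rightarrow> ('v \<Rightarrow> nat) \<Rightarrow> ('v \<Rightarrow> complex) \<Rightarrow> ('v \<Rightarrow> complex) \<Rightarrow> complex" where
  "fin_inner A w f g = (\<Sum>v\<in>A. f v * cnj (g v) / of_nat (w v))"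

lemma fin_inner_simps:
  "fin_inner A w (\<lambda>v. f v + g v) h = fin_inner A w f h + fin_inner A w g h"
  "fin_inner A w h (\<lambda>v. f v + g v) = fin_inner A w h f + fin_inner A w h g"
  "fin_inner A w (\<lambda>v. c * f v) h = c * fin_inner A w f h"
  "fin_inner A w h (\<lambda>v. c * f v) = cnj c * fin_inner A w h f"
  unfolding fin_inner_def
  by (simp_all add: sum.distrib sum_distrib_left add_divide_distrib ring_distribs algebra_simps)

lemma fin_inner_cong:
  "(\<And>v. v \<in> A \<Longrightarrow> f v = f' v) \<Longrightarrow> (\<And>v. v \<in> A \<Longrightarrow> g v = g' v) \<Longrightarrow> fin_inner A w f g = fin_inner A w f' g'"
  unfolding fin_inner_def by (simp cong: sum.cong)

lemma cnj_fin_inner: "cnj (fin_inner A w f g) = fin_inner A w g f"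
  unfolding fin_inner_def by (simp add: mult.commute)

lemma fin_inner_self:
  "fin_inner A w f f = complex_of_real (\<Sum>v\<in>A. (cmod (f v))\<^sup>2 / real (w v))"
  unfolding fin_inner_def by (simp add: complex_norm_square del: of_real_power) 

lemma fin_inner_self_pos:
  assumes "finite A" and "\<forall>v\<in>A. w v > 0" and "v \<in> A" "f v \<noteq> 0"
  shows "Re (fin_inner A w f f) > 0"
proof -
  have "0 < (cmod (f v))\<^sup>2 / real (w v)"
    using assms by simp
  also have "\<dots> \<le> (\<Sum>v\<in>A. (cmod (f v))\<^sup>2 / real (w v))"
    using assms by (intro member_le_sum) auto
  finally show ?thesis by (simp add: fin_inner_self)
qed

text \<open>Linearity of \<open>T\<close> is assumed only in the form \<open>lin\<close>: on
  functions supported in \<open>A\<close> it acts through its matrix in the basis of indicator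
  functions.\<close>

lemma combination_of_coordinates:
  fixes T :: "('v \<Rightarrow> complex) \<Rightarrow> 'v \<Rightarrow> complex"
  assumes lin: "\<forall>f. (\<forall>u. u \<notin> A \<longrightarrow> f u = 0) \<longrightarrow>
        (\<forall>v\<in>A. T f v = (\<Sum>u\<in>A. f u * T (\<lambda>x. if x = u then 1 else 0) v))"
    and out: "\<forall>u. u \<notin> A \<longrightarrow> f u = 0" "\<forall>u. u \<notin> A \<longrightarrow> g u = 0" and v: "v \<in> A"
  shows "T (\<lambda>v. x * f v + y * g v) v = x * T f v + y * T g v"
proof -
  have "T (\<lambda>v. x * f v + y * g v) v = (\<Sum>u\<in>A. (x * f u + y * g u) * T (\<lambda>x. if x = u then 1 else 0) v)"
    using out v by (intro lin[rule_format]) auto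
  moreover have "T f v = (\<Sum>u\<in>A. f u * T (\<lambda>x. if x = u then 1 else 0) v)"
    "T g v = (\<Sum>u\<in>A. g u * T (\<lambda>x. if x = u then 1 else 0) v)"
    using out v by (auto intro!: lin[rule_format])
  ultimately show ?thesis
    by (simp only: sum_distrib_left distrib_right mult.assoc flip: sum.distrib)
qed

text \<open>Only the first two columns of a Schur decomposition are needed: they span an invariant plane,
  on which self-adjointness turns triangular into diagonal.\<close>

lemma orthogonal_eigenfunctions:
  fixes T :: "('v \<Rightarrow> complex) \<Rightarrow> 'v \<Rightarrow> complex" and a b :: complex
  assumes vs: "distinct vs" "set vs = A"
    and cp: "char_poly (operator_mat vs T) = (\<Prod>c\<leftarrow>a # b # es. [:- c, 1:])"
    and w: "\<forall>v\<in>A. w v > 0"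
    and lin: "\<forall>f. (\<forall>u. u \<notin> A \<longrightarrow> f u = 0) \<longrightarrow>
        (\<forall>v\<in>A. T f v = (\<Sum>u\<in>A. f u * T (\<lambda>x. if x = u then 1 else 0) v))"
    and sa: "\<And>f g. (\<forall>u. u \<notin> A \<longrightarrow> f u = 0) \<Longrightarrow> (\<forall>u. u \<notin> A \<longrightarrow> g u = 0) \<Longrightarrow>
        fin_inner A w (T f) g = fin_inner A w f (T g)"
  obtains f g where "\<forall>u. u \<notin> A \<longrightarrow> f u = 0" "\<forall>u. u \<notin> A \<longrightarrow> g u = 0"
    "\<exists>v\<in>A. f v \<noteq> 0" "\<exists>v\<in>A. g v \<noteq> 0" "fin_inner A w f g = 0"
    "\<And>v. v \<in> A \<Longrightarrow> T f v = a * f v" "\<And>v. v \<in> A \<Longrightarrow> T g v = b * g v"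
proof -
  let ?n = "length vs"
  let ?M = "operator_mat vs T"
  have finA: "finite A" using vs by auto
  have M: "?M \<in> carrier_mat ?n ?n" unfolding operator_mat_def by simp
  obtain p1 p2 c where p: "p1 \<in> carrier_vec ?n" "p2 \<in> carrier_vec ?n"
    and Mp1: "?M *\<^sub>v p1 = a \<cdot>\<^sub>v p1" and Mp2: "?M *\<^sub>v p2 = c \<cdot>\<^sub>v p1 + b \<cdot>\<^sub>v p2"
    and indep: "\<And>x y. x \<cdot>\<^sub>v p1 + y \<cdot>\<^sub>v p2 = 0\<^sub>v ?n \<Longrightarrow> x = 0 \<and> y = 0"
    using triangular_pair[OF M cp] by metis
  define idx where "idx = inv_into {..<?n} (\<lambda>i. vs ! i)"
  have inj: "inj_on (\<lambda>i. vs ! i) {..<?n}"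
    using vs by (simp add: inj_on_nth)
  have idx: "idx (vs ! i) = i" if "i < ?n" for i
    unfolding idx_def using inv_into_f_f[OF inj] that by simp
  \<comment> \<open>Coordinate vectors become functions along the enumeration \<open>vs\<close>,
    extended by zero.\<close>
  define fn where "fn p = (\<lambda>v. if v \<in> A then p $ idx v else 0)" for p :: "complex vec"
  have fn_out: "fn p u = 0" if "u \<notin> A" for p u using that by (simp add: fn_def)
  have fn_nth: "fn p (vs ! i) = p $ i" if "i < ?n" for p i
    using that vs by (auto simp: fn_def idx)
  have T_fn: "T (fn p) (vs ! i) = (?M *\<^sub>v p) $ i" if "i < ?n" "p \<in> carrier_vec ?n" for p i
  proof -
    have "T (fn p) (vs ! i) = (\<Sum>u\<in>A. fn p u * T (\<lambda>x. if x = u then 1 else 0) (vs ! i))"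
      using that vs fn_out by (intro lin[rule_format]) auto
    also have "\<dots> = (\<Sum>j<?n. fn p (vs ! j) * T (\<lambda>x. if x = vs ! j then 1 else 0) (vs ! i))"
      using vs by (intro sum.reindex_bij_betw[symmetric] bij_betw_nth) auto
    also have "\<dots> = (?M *\<^sub>v p) $ i"
      using that unfolding operator_mat_def
      by (auto simp: scalar_prod_def fn_nth atLeast0LessThan mult.commute intro!: sum.cong)
    finally show ?thesis .
  qed
  have nth_ex: "\<exists>i<?n. v = vs ! i" if "v \<in> A" for v
    using that vs by (metis in_set_conv_nth)
  define f where "f = fn p1"
  define h where "h = fn p2"
  have Tf: "T f v = a * f v" if v: "v \<in> A" for v
  proof -
    obtain i where "i < ?n" "v = vs ! i" using nth_ex[OF v] by blast
    then show ?thesis using p T_fn[of i p1] by (simp add: f_def fn_nth Mp1)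
  qed
  have Th: "T h v = c * f v + b * h v" if v: "v \<in> A" for v
  proof -
    obtain i where "i < ?n" "v = vs ! i" using nth_ex[OF v] by blast
    then show ?thesis using p T_fn[of i p2] by (simp add: f_def h_def fn_nth Mp2)
  qed
  have indep_fn: "x = 0 \<and> y = 0" if "\<And>v. v \<in> A \<Longrightarrow> x * f v + y * h v = 0" for x y
  proof (rule indep, rule eq_vecI)
    fix i assume "i < dim_vec (0\<^sub>v ?n :: complex vec)"
    then have i: "i < ?n" by simp
    then have "x * f (vs ! i) + y * h (vs ! i) = 0" using that vs by auto
    then show "(x \<cdot>\<^sub>v p1 + y \<cdot>\<^sub>v p2) $ i = 0\<^sub>v ?n $ i"
      using i p by (simp add: f_def h_def fn_nth)
  qed (use p in auto)
  have f_ne: "\<exists>v\<in>A. f v \<noteq> 0"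
    using indep_fn[of 1 0] by auto
  define N where "N = fin_inner A w f f"
  have N: "N \<noteq> 0"
  proof -
    obtain v where v: "v \<in> A" "f v \<noteq> 0" using f_ne by blast
    have "Re N > 0"
      unfolding N_def by (rule fin_inner_self_pos[where A = A and f = f]) (use finA w v in auto)
    then show ?thesis by auto
  qed
  \<comment> \<open>A Gram-Schmidt step: this coefficient makes \<open>h + k f\<close> orthogonal to
    \<open>f\<close>.\<close>
  define k where "k = - fin_inner A w h f / N"
  define g where "g = (\<lambda>v. h v + k * f v)"
  have g_ne: "\<exists>v\<in>A. g v \<noteq> 0"
    using indep_fn[of k 1] by (auto simp: g_def algebra_simps)
  have g_out: "g u = 0" and f_out: "f u = 0" and h_out: "h u = 0" if "u \<notin> A" for u
    using that by (simp_all add: g_def f_def h_def fn_out)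
  have f_out': "\<forall>u. u \<notin> A \<longrightarrow> f u = 0" and g_out': "\<forall>u. u \<notin> A \<longrightarrow> g u = 0"
    and h_out': "\<forall>u. u \<notin> A \<longrightarrow> h u = 0"
    using f_out g_out h_out by blast+
  have gf: "fin_inner A w g f = 0"
    unfolding g_def fin_inner_simps using N by (simp add: k_def N_def[symmetric])
  then have fg: "fin_inner A w f g = 0"
    by (metis cnj_fin_inner complex_cnj_zero)
  \<comment> \<open>The off-diagonal entry of \<open>T\<close> in the basis \<open>f\<close>,
    \<open>g\<close>, found by substituting \<open>h = g - k f\<close> into
    \<open>T h + k T f\<close>.\<close>
  define d where "d = c + k * a - k * b"
  have Tg: "T g v = b * g v + d * f v" if v: "v \<in> A" for v
  proof -
    have "T g v = T h v + k * T f v"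
      using combination_of_coordinates[where x = 1 and y = k, OF lin h_out' f_out' v] by (simp add: g_def)
    then show ?thesis using Tf Th v by (simp add: g_def d_def algebra_simps)
  qed
  \<comment> \<open>Moving \<open>T\<close> across the inner product equates a multiple of
    \<open><g, f> = 0\<close> with \<open><T g, f> = d N\<close>, which forces \<open>d\<close> to
    vanish.\<close>
  have "0 = cnj a * fin_inner A w g f" using gf by simp
  also have "\<dots> = fin_inner A w g (\<lambda>v. a * f v)" by (simp add: fin_inner_simps)
  also have "\<dots> = fin_inner A w g (T f)" by (rule fin_inner_cong) (auto simp: Tf)
  also have "\<dots> = fin_inner A w (T g) f" using sa[OF g_out' f_out'] by simp
  also have "\<dots> = fin_inner A w (\<lambda>v. b * g v + d * f v) f"
    by (rule fin_inner_cong) (auto simp: Tg)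
  also have "\<dots> = d * N" by (simp add: fin_inner_simps gf N_def)
  finally have "d = 0" using N by simp
  then have "T g v = b * g v" if "v \<in> A" for v using Tg[OF that] by simp
  then show ?thesis using that[of f g] f_out' g_out' f_ne g_ne fg Tf by blast
qed

text \<open>A plane contains a nonzero vector orthogonal to any given \<open>k\<close>, and on the
  span of two orthogonal eigenfunctions the Rayleigh quotient is a weighted mean of \<open>a\<close>
  and \<open>b\<close>.\<close>

lemma rayleigh_quotient_between:
  fixes T :: "('v \<Rightarrow> complex) \<Rightarrow> 'v \<Rightarrow> complex" and a b :: real
  assumes vs: "distinct vs" "set vs = A"
    and cp: "char_poly (operator_mat vs T) =
      (\<Prod>c\<leftarrow>complex_of_real a # complex_of_real b # es. [:- c, 1:])"
    and w: "\<forall>v\<in>A. w v > 0"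
    and lin: "\<forall>f. (\<forall>u. u \<notin> A \<longrightarrow> f u = 0) \<longrightarrow>
        (\<forall>v\<in>A. T f v = (\<Sum>u\<in>A. f u * T (\<lambda>x. if x = u then 1 else 0) v))"
    and sa: "\<And>f g. (\<forall>u. u \<notin> A \<longrightarrow> f u = 0) \<Longrightarrow> (\<forall>u. u \<notin> A \<longrightarrow> g u = 0) \<Longrightarrow>
        fin_inner A w (T f) g = fin_inner A w f (T g)"
  obtains f where "\<forall>u. u \<notin> A \<longrightarrow> f u = 0" "Re (fin_inner A w f f) > 0"
    "fin_inner A w f k = 0"
    "min a b * Re (fin_inner A w f f) \<le> Re (fin_inner A w (T f) f)"
    "Re (fin_inner A w (T f) f) \<le> max a b * Re (fin_inner A w f f)"
proof -
  have finA: "finite A" using vs by auto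
  show ?thesis
  proof (rule orthogonal_eigenfunctions[where T = T, OF vs cp w lin sa])
    fix g h :: "'v \<Rightarrow> complex"
    assume out: "\<forall>u. u \<notin> A \<longrightarrow> g u = 0" "\<forall>u. u \<notin> A \<longrightarrow> h u = 0"
      and ne: "\<exists>v\<in>A. g v \<noteq> 0" "\<exists>v\<in>A. h v \<noteq> 0" and gh: "fin_inner A w g h = 0"
      and Tg: "\<And>v. v \<in> A \<Longrightarrow> T g v = a * g v" and Th: "\<And>v. v \<in> A \<Longrightarrow> T h v = b * h v"
    have hg: "fin_inner A w h g = 0"
      using gh by (metis cnj_fin_inner complex_cnj_zero)
    \<comment> \<open>One linear equation in two unknowns. The crosswise solution is nonzero unless
      \<open><g, k> = 0\<close>, and then \<open>g\<close> itself serves.\<close>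
    obtain x y :: complex where xy: "x \<noteq> 0 \<or> y \<noteq> 0"
      and k: "x * fin_inner A w g k + y * fin_inner A w h k = 0"
    proof (cases "fin_inner A w g k = 0")
      case True
      then show ?thesis using that[of 1 0] by simp
    next
      case False
      then show ?thesis
        using that[of "- fin_inner A w h k" "fin_inner A w g k"] by (simp add: mult.commute)
    qed
    define f where "f = (\<lambda>v. x * g v + y * h v)"
    \<comment> \<open>Squared norms of the two components of \<open>f\<close>. As cross terms
      vanish, \<open>f\<close> has squared norm \<open>X + Y\<close> and \<open><T f, f>\<close> has
      real part \<open>a X + b Y\<close>.\<close>
    define X where "X = (cmod x)\<^sup>2 * Re (fin_inner A w g g)"
    define Y where "Y = (cmod y)\<^sup>2 * Re (fin_inner A w h h)"
    have pos: "Re (fin_inner A w g g) > 0" "Re (fin_inner A w h h) > 0"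
      using ne fin_inner_self_pos[OF finA w] by blast+
    have XY: "X \<ge> 0" "Y \<ge> 0" "X + Y > 0"
      using pos xy unfolding X_def Y_def by (auto intro: add_nonneg_pos add_pos_nonneg)
    have real: "Im (fin_inner A w u u) = 0" for u by (simp add: fin_inner_self)
    have Tf: "T f v = x * (a * g v) + y * (b * h v)" if v: "v \<in> A" for v
    proof -
      have "T f v = x * T g v + y * T h v"
        unfolding f_def by (rule combination_of_coordinates[OF lin out v])
      then show ?thesis using Tg Th v by simp
    qed
    have re: "Re (x * cnj x * z) = (cmod x)\<^sup>2 * Re z" for x z
      by (simp flip: complex_norm_square)
    have ff: "Re (fin_inner A w f f) = X + Y"
      unfolding f_def fin_inner_simps X_def Y_def re[symmetric] by (simp add: gh hg algebra_simps)
    have "fin_inner A w (T f) f = fin_inner A w (\<lambda>v. x * (a * g v) + y * (b * h v)) f"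
      by (rule fin_inner_cong) (auto simp: Tf)
    also have "\<dots> = a * (x * cnj x * fin_inner A w g g) + b * (y * cnj y * fin_inner A w h h)"
      unfolding f_def fin_inner_simps by (simp add: gh hg algebra_simps)
    finally have Tff: "Re (fin_inner A w (T f) f) = a * X + b * Y"
      unfolding X_def Y_def re[symmetric] by simp
    have "min a b * (X + Y) \<le> a * X + b * Y"
      unfolding distrib_left using XY by (intro add_mono mult_right_mono) auto
    moreover have "a * X + b * Y \<le> max a b * (X + Y)"
      unfolding distrib_left using XY by (intro add_mono mult_right_mono) auto
    moreover have "fin_inner A w f k = 0"
      using k by (simp add: f_def fin_inner_simps)
    moreover have "f u = 0" if "u \<notin> A" for u using out that by (simp add: f_def)
    ultimately show thesis using that[of f] XY ff Tff by simp
  qed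
qed

section \<open>The adjacency form of a regular diagram\<close>

text \<open>The AM-GM inequality, applied term by term: it yields summable majorants over vertices
  and edges, and after summation over edges the bound \<open>q + 1\<close> for the adjacency
  form.\<close>

lemma cmod_mult_cnj_le: "cmod (x * cnj y) \<le> (cmod x)\<^sup>2 / 2 + (cmod y)\<^sup>2 / 2"
  using sum_squares_bound[of "cmod x" "cmod y"] by (simp add: norm_mult field_simps)

context regular_diagram
begin

abbreviation "inner_G \<equiv> L2_inner G wv"
abbreviation "adj_G \<equiv> adjacency G we wv"
abbreviation "diagM \<equiv> diagram_M G we wv Vo Vi"

definition sqnorm :: "('v \<Rightarrow> complex) \<Rightarrow> real" where
  "sqnorm f = (\<Sum>\<^sub>\<infinity>v\<in>verts G. (cmod (f v))\<^sup>2 / real (wv v))"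

text \<open>The form \<open><delta f, g>\<close> as a sum over oriented edges, a shape on which edge
  reversal acts by reindexing.\<close>

definition edge_form :: "('v \<Rightarrow> complex) \<Rightarrow> ('v \<Rightarrow> complex) \<Rightarrow> complex" where
  "edge_form f g = (\<Sum>\<^sub>\<infinity>e\<in>arcs G. f (tail G e) * cnj (g (head G e)) / of_nat (we e))"

definition all_one :: "'v \<Rightarrow> complex" where
  "all_one v = (if v \<in> verts G then 1 else 0)"

definition bipartition_sign :: "'v \<Rightarrow> complex" where
  "bipartition_sign v = (if v \<in> Vo then 1 else if v \<in> Vi then - 1 else 0)"

section \<open>The space of square-summable functions\<close>

lemma L2_outside: "f \<in> L2 G wv \<Longrightarrow> v \<notin> verts G \<Longrightarrow> f v = 0"
  by (simp add: L2_def)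

lemma L2_summable: "f \<in> L2 G wv \<Longrightarrow> (\<lambda>v. (cmod (f v))\<^sup>2 / real (wv v)) summable_on verts G"
  by (simp add: L2_def)

lemma L2_add:
  assumes "f \<in> L2 G wv" "g \<in> L2 G wv"
  shows "(\<lambda>v. f v + g v) \<in> L2 G wv"
proof -
  have "(\<lambda>v. 2 * ((cmod (f v))\<^sup>2 / real (wv v)) + 2 * ((cmod (g v))\<^sup>2 / real (wv v)))
      summable_on verts G"
    using assms by (intro summable_on_add summable_on_cmult_right L2_summable)
  moreover have "(cmod (f v + g v))\<^sup>2 / real (wv v)
      \<le> 2 * ((cmod (f v))\<^sup>2 / real (wv v)) + 2 * ((cmod (g v))\<^sup>2 / real (wv v))" for v
  proof -
    have "(cmod (f v + g v))\<^sup>2 \<le> (cmod (f v) + cmod (g v))\<^sup>2"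
      by (intro power_mono norm_triangle_ineq) auto
    also have "\<dots> \<le> 2 * (cmod (f v))\<^sup>2 + 2 * (cmod (g v))\<^sup>2"
      using sum_squares_bound[of "cmod (f v)" "cmod (g v)"] by (simp add: power2_sum)
    finally show ?thesis
      by (simp add: divide_right_mono flip: add_divide_distrib)
  qed
  ultimately have "(\<lambda>v. (cmod (f v + g v))\<^sup>2 / real (wv v)) summable_on verts G"
    by (rule summable_on_comparison_test) auto
  then show ?thesis using assms by (simp add: L2_def)
qed

lemma L2_scale:
  assumes "f \<in> L2 G wv"
  shows "(\<lambda>v. c * f v) \<in> L2 G wv"
  using assms summable_on_cmult_right[OF L2_summable[OF assms], of "(cmod c)\<^sup>2"]
  by (simp add: L2_def norm_mult power_mult_distrib)

text \<open>Since the total mass is finite, the constant 1 is a summable majorant.\<close>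

lemma L2_bounded:
  assumes "\<And>v. v \<notin> verts G \<Longrightarrow> f v = 0" "\<And>v. cmod (f v) \<le> 1"
  shows "f \<in> L2 G wv"
  unfolding L2_def using assms
  by (auto intro!: summable_on_comparison_test[OF finite_measure] divide_right_mono power_le_one)

lemma L2_all_one: "all_one \<in> L2 G wv"
  by (rule L2_bounded) (auto simp: all_one_def)

lemma L2_bipartition_sign: "bipartition_sign \<in> L2 G wv"
  by (rule L2_bounded) (auto simp: bipartition_sign_def bipartition(1))

lemma L2_finite_support:
  assumes "finite A" "A \<subseteq> verts G" "\<And>v. v \<notin> A \<Longrightarrow> f v = 0"
  shows "f \<in> L2 G wv"
proof -
  have "{v \<in> verts G. (cmod (f v))\<^sup>2 / real (wv v) \<noteq> 0} \<subseteq> A"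
    using assms(3) by force
  then have "(\<lambda>v. (cmod (f v))\<^sup>2 / real (wv v)) summable_on verts G"
    using finite_subset[OF _ assms(1)] by (intro finite_nonzero_values_imp_summable_on) auto
  then show ?thesis using assms(2,3) by (auto simp: L2_def)
qed

lemma inner_summable:
  assumes "f \<in> L2 G wv" "g \<in> L2 G wv"
  shows "(\<lambda>v. f v * cnj (g v) / of_nat (wv v)) summable_on verts G"
proof -
  have "(\<lambda>v. (1/2) * ((cmod (f v))\<^sup>2 / real (wv v)) + (1/2) * ((cmod (g v))\<^sup>2 / real (wv v)))
      summable_on verts G"
    using assms by (intro summable_on_add summable_on_cmult_right L2_summable)
  then have "(\<lambda>v. norm (f v * cnj (g v) / of_nat (wv v))) summable_on verts G"
  proof (rule Infinite_Sum.abs_summable_on_comparison_test')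
    fix v
    show "norm (f v * cnj (g v) / of_nat (wv v))
        \<le> (1/2) * ((cmod (f v))\<^sup>2 / real (wv v)) + (1/2) * ((cmod (g v))\<^sup>2 / real (wv v))"
      using divide_right_mono[OF cmod_mult_cnj_le[of "f v" "g v"], of "real (wv v)"]
      by (simp add: norm_divide add_divide_distrib)
  qed
  then show ?thesis by (rule abs_summable_summable)
qed

lemma inner_add_left:
  "\<lbrakk>f \<in> L2 G wv; g \<in> L2 G wv; h \<in> L2 G wv\<rbrakk> \<Longrightarrow> inner_G (\<lambda>v. f v + g v) h = inner_G f h + inner_G g h"
  unfolding L2_inner_def
  by (simp add: inner_summable distrib_right add_divide_distrib flip: infsum_add)

lemma inner_scale_left: "inner_G (\<lambda>v. c * f v) h = c * inner_G f h"
  unfolding L2_inner_def by (simp add: mult.assoc flip: infsum_cmult_right')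

lemma cnj_inner: "cnj (inner_G f g) = inner_G g f"
proof -
  have "inner_G g f = (\<Sum>\<^sub>\<infinity>v\<in>verts G. cnj (f v * cnj (g v) / of_nat (wv v)))"
    unfolding L2_inner_def by (rule infsum_cong) simp
  also have "\<dots> = cnj (inner_G f g)" unfolding L2_inner_def by (rule infsum_cnj)
  finally show ?thesis by simp
qed

lemma inner_add_right:
  "\<lbrakk>f \<in> L2 G wv; g \<in> L2 G wv; h \<in> L2 G wv\<rbrakk> \<Longrightarrow> inner_G h (\<lambda>v. f v + g v) = inner_G h f + inner_G h g"
  using arg_cong[OF inner_add_left[of f g h], of cnj] by (simp add: cnj_inner)

lemma inner_scale_right: "inner_G h (\<lambda>v. c * f v) = cnj c * inner_G h f"
  using arg_cong[OF inner_scale_left[of c f h], of cnj] by (simp add: cnj_inner)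

lemma inner_self:
  assumes "f \<in> L2 G wv"
  shows "inner_G f f = complex_of_real (sqnorm f)"
proof -
  have "((\<lambda>v. complex_of_real ((cmod (f v))\<^sup>2 / real (wv v))) has_sum complex_of_real (sqnorm f))
      (verts G)"
    unfolding sqnorm_def using L2_summable[OF assms] by (intro has_sum_of_real has_sum_infsum)
  then show ?thesis
    unfolding L2_inner_def
    by (intro infsumI) (simp add: complex_norm_square del: of_real_power)
qed

lemma sqnorm_nonneg: "sqnorm f \<ge> 0"
  unfolding sqnorm_def by (intro infsum_nonneg) auto

lemma sqnorm_eq_0:
  assumes "f \<in> L2 G wv" "sqnorm f = 0"
  shows "f v = 0"
proof (cases "v \<in> verts G")
  case True
  then have "(cmod (f v))\<^sup>2 / real (wv v) = 0"
    using assms by (intro nonneg_infsum_le_0D[where A = "verts G"]) (auto simp: sqnorm_def L2_summable)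
  then show ?thesis using vertex_weight_pos[OF True] by simp
qed (use assms L2_outside in auto)

lemma sqnorm_scale: "sqnorm (\<lambda>v. c * f v) = (cmod c)\<^sup>2 * sqnorm f"
  unfolding sqnorm_def by (simp add: norm_mult power_mult_distrib flip: infsum_cmult_right')

section \<open>Sums over oriented edges and the adjacency form\<close>

lemma arcs_bij_Sigma: "bij_betw snd (Sigma (verts G) (in_arcs G)) (arcs G)"
  by (rule bij_betw_byWitness[where f' = "\<lambda>e. (head G e, e)"]) (auto simp: in_arcs_def)

text \<open>Fubini with finite fibres: edges are grouped by their heads.\<close>

lemma has_sum_in_arcs:
  fixes g :: "'e \<Rightarrow> 'c :: {comm_monoid_add,uniform_space,uniform_topological_group_add}"
  assumes "(g has_sum S) (arcs G)"
  shows "((\<lambda>v. \<Sum>e\<in>in_arcs G v. g e) has_sum S) (verts G)"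
proof (rule has_sum_Sigma')
  show "((\<lambda>x. g (snd x)) has_sum S) (Sigma (verts G) (in_arcs G))"
    using assms has_sum_reindex_bij_betw[OF arcs_bij_Sigma] by blast
qed (auto intro!: has_sum_finiteI locally_finite)

text \<open>The converse passage in the manner of Tonelli, valid by nonnegativity.\<close>

lemma arcs_summable:
  fixes g :: "'e \<Rightarrow> real"
  assumes "\<And>e. g e \<ge> 0" and "(\<lambda>v. \<Sum>e\<in>in_arcs G v. g e) summable_on verts G"
  shows "g summable_on arcs G"
proof -
  have "(\<lambda>x. g (snd x)) summable_on Sigma (verts G) (in_arcs G)"
    by (rule summable_on_SigmaI[OF _ assms(2)]) (auto intro!: has_sum_finiteI locally_finite assms)
  then show ?thesis using summable_on_reindex_bij_betw[OF arcs_bij_Sigma] by blast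
qed

lemma arev_bij: "bij_betw arev (arcs G) (arcs G)"
  by (rule bij_betw_byWitness[where f' = arev]) auto

text \<open>Regularity divided by \<open>w(v)\<close>: the reciprocal weights of the edges ending at
  \<open>v\<close> add up to \<open>(q + 1) / w(v)\<close>.\<close>

lemma sum_in_arcs_head:
  assumes "v \<in> verts G"
  shows "(\<Sum>e\<in>in_arcs G v. x (head G e) / real (we e)) = (real q + 1) * (x v / real (wv v))"
proof -
  have "(\<Sum>e\<in>in_arcs G v. x (head G e) / real (we e)) = weighted_degree G we wv v * (x v / real (wv v))"
    unfolding weighted_degree_def sum_distrib_right
    using vertex_weight_pos[OF assms] by (intro sum.cong) (auto simp: in_arcs_def)
  then show ?thesis by (simp only: regular[OF assms])
qed

lemma has_sum_head:
  assumes "f \<in> L2 G wv"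
  shows "((\<lambda>e. (cmod (f (head G e)))\<^sup>2 / real (we e)) has_sum (real q + 1) * sqnorm f) (arcs G)"
proof -
  let ?g = "\<lambda>e. (cmod (f (head G e)))\<^sup>2 / real (we e)"
  have "((\<lambda>v. (real q + 1) * ((cmod (f v))\<^sup>2 / real (wv v))) has_sum (real q + 1) * sqnorm f) (verts G)"
    unfolding sqnorm_def using L2_summable[OF assms]
    by (intro has_sum_cmult_right has_sum_infsum)
  then have *: "((\<lambda>v. \<Sum>e\<in>in_arcs G v. ?g e) has_sum (real q + 1) * sqnorm f) (verts G)"
    by (subst has_sum_cong[OF sum_in_arcs_head])
  then have "?g summable_on arcs G"
    by (intro arcs_summable) (auto dest: has_sum_imp_summable)
  then have "(?g has_sum infsum ?g (arcs G)) (arcs G)" by simp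
  moreover from has_sum_in_arcs[OF this] * have "infsum ?g (arcs G) = (real q + 1) * sqnorm f"
    by (rule has_sum_unique)
  ultimately show ?thesis by simp
qed

text \<open>Edge reversal turns tails into heads and preserves edge weights.\<close>

lemma has_sum_tail:
  assumes "f \<in> L2 G wv"
  shows "((\<lambda>e. (cmod (f (tail G e)))\<^sup>2 / real (we e)) has_sum (real q + 1) * sqnorm f) (arcs G)"
proof -
  have "((\<lambda>e. (cmod (f (head G (arev e))))\<^sup>2 / real (we (arev e)))
      has_sum (real q + 1) * sqnorm f) (arcs G)"
    using has_sum_head[OF assms]
    by (subst has_sum_reindex_bij_betw[OF arev_bij, of "\<lambda>e. (cmod (f (head G e)))\<^sup>2 / real (we e)"])
  then show ?thesis by (rule has_sum_cong[THEN iffD1, rotated]) (simp add: edge_weight_arev)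
qed

text \<open>This dominates the terms of \<open>edge_form\<close>. For \<open>g = f\<close> its total
  is \<open>(q + 1) * sqnorm f\<close>, the bound of the adjacency form.\<close>

lemma edge_form_majorant:
  assumes "f \<in> L2 G wv" "g \<in> L2 G wv"
  shows "((\<lambda>e. (1/2) * ((cmod (f (tail G e)))\<^sup>2 / real (we e))
      + (1/2) * ((cmod (g (head G e)))\<^sup>2 / real (we e)))
    has_sum (1/2) * ((real q + 1) * sqnorm f) + (1/2) * ((real q + 1) * sqnorm g)) (arcs G)"
  using assms by (intro has_sum_add has_sum_cmult_right has_sum_head has_sum_tail)

lemma edge_form_norm_le:
  "cmod (f (tail G e) * cnj (g (head G e)) / of_nat (we e))
    \<le> (1/2) * ((cmod (f (tail G e)))\<^sup>2 / real (we e)) + (1/2) * ((cmod (g (head G e)))\<^sup>2 / real (we e))"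
  using divide_right_mono[OF cmod_mult_cnj_le[of "f (tail G e)" "g (head G e)"], of "real (we e)"]
  by (simp add: norm_divide add_divide_distrib)

lemma edge_form_summable:
  assumes "f \<in> L2 G wv" "g \<in> L2 G wv"
  shows "(\<lambda>e. f (tail G e) * cnj (g (head G e)) / of_nat (we e)) summable_on arcs G"
proof (rule abs_summable_summable)
  show "(\<lambda>e. norm (f (tail G e) * cnj (g (head G e)) / of_nat (we e))) summable_on arcs G"
    by (rule Infinite_Sum.abs_summable_on_comparison_test'[OF has_sum_imp_summable[OF edge_form_majorant[OF assms]]])
       (rule edge_form_norm_le)
qed

lemma edge_form_bound:
  assumes "f \<in> L2 G wv"
  shows "Re (edge_form f f) \<le> (real q + 1) * sqnorm f"
proof -
  have "((\<lambda>e. Re (f (tail G e) * cnj (f (head G e)) / of_nat (we e))) has_sum Re (edge_form f f)) (arcs G)"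
    unfolding edge_form_def by (intro has_sum_Re has_sum_infsum edge_form_summable assms)
  then have "Re (edge_form f f) \<le> (1/2) * ((real q + 1) * sqnorm f) + (1/2) * ((real q + 1) * sqnorm f)"
    using edge_form_majorant[OF assms assms]
    by (rule has_sum_mono) (rule order_trans[OF complex_Re_le_cmod edge_form_norm_le])
  then show ?thesis by (simp add: mult.commute)
qed

text \<open>With edges grouped by head, the factor \<open>w(v) / w(e)\<close> of the adjacency
  operator and \<open>1 / w(v)\<close> of the inner product leave \<open>1 / w(e)\<close>.\<close>

lemma inner_adjacency:
  assumes "f \<in> L2 G wv" "g \<in> L2 G wv"
  shows "inner_G (adj_G f) g = edge_form f g"
proof -
  let ?t = "\<lambda>e. f (tail G e) * cnj (g (head G e)) / of_nat (we e)"
  have "(?t has_sum edge_form f g) (arcs G)"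
    unfolding edge_form_def by (intro has_sum_infsum edge_form_summable assms)
  then have "((\<lambda>v. \<Sum>e\<in>in_arcs G v. ?t e) has_sum edge_form f g) (verts G)"
    by (rule has_sum_in_arcs)
  also have "?this \<longleftrightarrow> ((\<lambda>v. adj_G f v * cnj (g v) / of_nat (wv v)) has_sum edge_form f g) (verts G)"
  proof (rule has_sum_cong)
    fix v assume v: "v \<in> verts G"
    show "(\<Sum>e\<in>in_arcs G v. ?t e) = adj_G f v * cnj (g v) / of_nat (wv v)"
      unfolding adjacency_def sum_distrib_right sum_divide_distrib
      using vertex_weight_pos[OF v] by (intro sum.cong) (auto simp: in_arcs_def)
  qed
  finally show ?thesis
    unfolding L2_inner_def by (rule infsumI)
qed

text \<open>Reindexing by \<open>arev\<close> swaps the roles of the two arguments, so the form is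
  Hermitian.\<close>

lemma cnj_edge_form: "cnj (edge_form f g) = edge_form g f"
proof -
  have "edge_form g f = (\<Sum>\<^sub>\<infinity>e\<in>arcs G. g (tail G (arev e)) * cnj (f (head G (arev e))) / of_nat (we (arev e)))"
    unfolding edge_form_def by (rule infsum_reindex_bij_betw[OF arev_bij, symmetric])
  also have "\<dots> = (\<Sum>\<^sub>\<infinity>e\<in>arcs G. cnj (f (tail G e) * cnj (g (head G e)) / of_nat (we e)))"
    by (rule infsum_cong) (simp add: edge_weight_arev mult.commute)
  also have "\<dots> = cnj (edge_form f g)" unfolding edge_form_def by (rule infsum_cnj)
  finally show ?thesis by simp
qed

lemma edge_form_add_left:
  "\<lbrakk>f \<in> L2 G wv; g \<in> L2 G wv; h \<in> L2 G wv\<rbrakk>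
    \<Longrightarrow> edge_form (\<lambda>v. f v + g v) h = edge_form f h + edge_form g h"
  unfolding edge_form_def
  by (simp add: edge_form_summable distrib_right add_divide_distrib flip: infsum_add)

lemma edge_form_scale_left: "edge_form (\<lambda>v. c * f v) h = c * edge_form f h"
  unfolding edge_form_def by (simp add: mult.assoc flip: infsum_cmult_right')

lemma edge_form_add_right:
  "\<lbrakk>f \<in> L2 G wv; g \<in> L2 G wv; h \<in> L2 G wv\<rbrakk>
    \<Longrightarrow> edge_form h (\<lambda>v. f v + g v) = edge_form h f + edge_form h g"
  using arg_cong[OF edge_form_add_left[of f g h], of cnj] by (simp add: cnj_edge_form)

lemma edge_form_scale_right: "edge_form h (\<lambda>v. c * f v) = cnj c * edge_form h f"
  using arg_cong[OF edge_form_scale_left[of c f h], of cnj] by (simp add: cnj_edge_form)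

section \<open>The two explicit eigenfunctions and the subspace \<open>L2_0\<close>\<close>

lemma edge_form_all_one:
  assumes "g \<in> L2 G wv"
  shows "edge_form all_one g = of_real (real q + 1) * inner_G all_one g"
proof -
  have "adj_G all_one v = of_real (real q + 1) * all_one v" if v: "v \<in> verts G" for v
  proof -
    have "adj_G all_one v = of_real (weighted_degree G we wv v)"
      unfolding adjacency_def weighted_degree_def of_real_sum
      by (intro sum.cong) (auto simp: all_one_def in_arcs_def)
    then show ?thesis using regular[OF v] v by (simp add: all_one_def)
  qed
  then have "inner_G (adj_G all_one) g = inner_G (\<lambda>v. of_real (real q + 1) * all_one v) g"
    unfolding L2_inner_def by (intro infsum_cong) simp
  then show ?thesis
    using inner_adjacency[OF L2_all_one assms] by (simp only: inner_scale_left)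
qed

lemma bipartition_sign_tail:
  "e \<in> arcs G \<Longrightarrow> bipartition_sign (tail G e) = - bipartition_sign (head G e)"
  using edges_bipartite[of e] bipartition(2) by (auto simp: bipartition_sign_def)

text \<open>Every edge crosses the bipartition, so all neighbours of \<open>v\<close> carry the
  opposite sign, and regularity yields the eigenvalue \<open>-(q + 1)\<close>.\<close>

lemma edge_form_bipartition_sign:
  assumes "g \<in> L2 G wv"
  shows "edge_form bipartition_sign g = - of_real (real q + 1) * inner_G bipartition_sign g"
proof -
  have "adj_G bipartition_sign v = - of_real (real q + 1) * bipartition_sign v" if v: "v \<in> verts G" for v
  proof -
    have "adj_G bipartition_sign v = - of_real (weighted_degree G we wv v) * bipartition_sign v"
      unfolding adjacency_def weighted_degree_def of_real_sum sum_negf[symmetric] sum_distrib_right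
      by (intro sum.cong) (auto simp: bipartition_sign_tail in_arcs_def)
    then show ?thesis using regular[OF v] by simp
  qed
  then have "inner_G (adj_G bipartition_sign) g = inner_G (\<lambda>v. - of_real (real q + 1) * bipartition_sign v) g"
    unfolding L2_inner_def by (intro infsum_cong) simp
  then show ?thesis
    using inner_adjacency[OF L2_bipartition_sign assms] by (simp only: inner_scale_left)
qed

text \<open>The two functions are eigenfunctions of the adjacency operator for \<open>-(q + 1) \<noteq> q + 1\<close>.\<close>

lemma inner_bipartition_sign_all_one: "inner_G bipartition_sign all_one = 0"
proof -
  have "- of_real (real q + 1) * inner_G bipartition_sign all_one = edge_form bipartition_sign all_one"
    by (simp add: edge_form_bipartition_sign[OF L2_all_one])
  also have "\<dots> = cnj (edge_form all_one bipartition_sign)"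
    by (simp add: cnj_edge_form)
  also have "\<dots> = of_real (real q + 1) * inner_G bipartition_sign all_one"
    unfolding edge_form_all_one[OF L2_bipartition_sign] by (simp add: cnj_inner)
  finally have "2 * (of_real (real q + 1) * inner_G bipartition_sign all_one) = 0"
    by (simp add: algebra_simps)
  then have "of_real (real q + 1) * inner_G bipartition_sign all_one = 0"
    by (simp only: mult_eq_0_iff) simp
  moreover have "complex_of_real (real q + 1) \<noteq> 0"
    unfolding of_real_eq_0_iff by linarith
  ultimately show ?thesis by (simp only: mult_eq_0_iff simp_thms)
qed

text \<open>The two inner products are the sum and the difference of the weighted sums over
  \<open>Vo\<close> and \<open>Vi\<close>.\<close>

lemma L2_0_iff:
  assumes f: "f \<in> L2 G wv"
  shows "f \<in> L2_0 G wv Vo Vi \<longleftrightarrow> inner_G f all_one = 0 \<and> inner_G f bipartition_sign = 0"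
proof -
  let ?s = "\<lambda>A. \<Sum>\<^sub>\<infinity>v\<in>A. f v / of_nat (wv v)"
  have summ: "(\<lambda>v. f v / of_nat (wv v)) summable_on verts G"
    using inner_summable[OF f L2_all_one]
    by (rule summable_on_cong[THEN iffD1, rotated]) (simp add: all_one_def)
  have summ_sign: "(\<lambda>v. f v * cnj (bipartition_sign v) / of_nat (wv v)) summable_on verts G"
    by (intro inner_summable f L2_bipartition_sign)
  have sub: "Vo \<subseteq> verts G" "Vi \<subseteq> verts G" using bipartition by auto
  have "inner_G f all_one = ?s (verts G)"
    unfolding L2_inner_def by (rule infsum_cong) (simp add: all_one_def)
  also have "\<dots> = ?s Vo + ?s Vi"
    using summ sub bipartition by (simp add: infsum_Un_disjoint summable_on_subset)
  finally have one: "inner_G f all_one = ?s Vo + ?s Vi" .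
  have "inner_G f bipartition_sign
      = (\<Sum>\<^sub>\<infinity>v\<in>Vo. f v * cnj (bipartition_sign v) / of_nat (wv v))
        + (\<Sum>\<^sub>\<infinity>v\<in>Vi. f v * cnj (bipartition_sign v) / of_nat (wv v))"
    unfolding L2_inner_def bipartition(1) using bipartition(2) sub summ_sign
    by (intro infsum_Un_disjoint) (auto intro: summable_on_subset)
  also have "(\<Sum>\<^sub>\<infinity>v\<in>Vo. f v * cnj (bipartition_sign v) / of_nat (wv v)) = ?s Vo"
    by (rule infsum_cong) (simp add: bipartition_sign_def)
  also have "(\<Sum>\<^sub>\<infinity>v\<in>Vi. f v * cnj (bipartition_sign v) / of_nat (wv v)) = (\<Sum>\<^sub>\<infinity>v\<in>Vi. - (f v / of_nat (wv v)))"
    by (rule infsum_cong) (use bipartition(2) in \<open>auto simp: bipartition_sign_def\<close>)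
  also have "\<dots> = - ?s Vi" by (rule infsum_uminus)
  finally have sign: "inner_G f bipartition_sign = ?s Vo - ?s Vi" by simp
  have "a = 0 \<and> b = 0 \<longleftrightarrow> b + a = 0 \<and> b - a = 0" for a b :: complex
    by (auto simp: eq_neg_iff_add_eq_0)
  then show ?thesis
    unfolding one sign L2_0_def using f by auto
qed

section \<open>Estimates of the adjacency form by \<open>M\<close>\<close>

lemma edge_form_le_M:
  assumes f0: "f \<in> L2_0 G wv Vo Vi"
  shows "Re (edge_form f f) \<le> diagM * sqnorm f"
proof (cases "sqnorm f = 0")
  case True
  have f: "f \<in> L2 G wv" using f0 by (simp add: L2_0_def)
  have "f = (\<lambda>v. 0)" using sqnorm_eq_0[OF f True] by auto
  then show ?thesis using True by (simp add: edge_form_def)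
next
  case False
  have f: "f \<in> L2 G wv" using f0 by (simp add: L2_0_def)
  have pos: "sqnorm f > 0" using False sqnorm_nonneg[of f] by simp
  \<comment> \<open>Both sides are homogeneous of degree two, so scaling to norm 1 brings
    \<open>f\<close> into the set that defines \<open>M\<close>.\<close>
  define c where "c = 1 / sqrt (sqnorm f)"
  define g where "g = (\<lambda>v. complex_of_real c * f v)"
  have c2: "c\<^sup>2 * sqnorm f = 1" using pos by (simp add: c_def power_divide)
  have g: "g \<in> L2 G wv" unfolding g_def by (rule L2_scale[OF f])
  have g0: "g \<in> L2_0 G wv Vo Vi"
    using f0 g unfolding L2_0_iff[OF f] L2_0_iff[OF g] by (simp add: g_def inner_scale_left)
  have norm: "L2_norm G wv g = 1"
    using c2 by (simp add: L2_norm_def inner_self[OF g]) (simp add: g_def sqnorm_scale)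
  \<comment> \<open>A real \<open>Sup\<close> is known to dominate the elements of its set only once
    the set is bounded above; \<open>q + 1\<close> is such a bound.\<close>
  have "bdd_above {Re (inner_G (adj_G f) f) | f. f \<in> L2_0 G wv Vo Vi \<and> L2_norm G wv f = 1}"
  proof (rule bdd_aboveI[where M = "real q + 1"], safe)
    fix h assume "h \<in> L2_0 G wv Vo Vi" and n: "L2_norm G wv h = 1"
    then have h: "h \<in> L2 G wv" by (simp add: L2_0_def)
    have "sqnorm h = 1" using n by (simp add: L2_norm_def inner_self[OF h])
    then show "Re (inner_G (adj_G h) h) \<le> real q + 1"
      using edge_form_bound[OF h] by (simp add: inner_adjacency[OF h h])
  qed
  then have "Re (inner_G (adj_G g) g) \<le> diagM"
    unfolding diagram_M_def using g0 norm by (intro cSup_upper) auto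
  moreover have "Re (inner_G (adj_G g) g) = c\<^sup>2 * Re (edge_form f f)"
    unfolding inner_adjacency[OF g g]
    by (simp add: g_def edge_form_scale_left edge_form_scale_right power2_eq_square)
  ultimately have "c\<^sup>2 * Re (edge_form f f) \<le> c\<^sup>2 * sqnorm f * diagM" by (simp add: c2)
  moreover have "c\<^sup>2 > 0" using pos by (simp add: c_def)
  ultimately show ?thesis by (simp add: mult.assoc mult.commute)
qed

text \<open>Changing the sign on one side of the bipartition turns the spectrum of the adjacency
  operator around.\<close>

definition flip :: "('v \<Rightarrow> complex) \<Rightarrow> 'v \<Rightarrow> complex" where
  "flip f v = bipartition_sign v * f v"

lemma cmod_flip: "v \<in> verts G \<Longrightarrow> cmod (flip f v) = cmod (f v)"
  using bipartition by (auto simp: flip_def bipartition_sign_def)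

lemma L2_flip:
  assumes "f \<in> L2 G wv"
  shows "flip f \<in> L2 G wv"
proof -
  have "(\<lambda>v. (cmod (flip f v))\<^sup>2 / real (wv v)) summable_on verts G"
    using L2_summable[OF assms] by (rule summable_on_cong[THEN iffD1, rotated]) (simp add: cmod_flip)
  then show ?thesis using L2_outside[OF assms] by (simp add: L2_def flip_def)
qed

lemma sqnorm_flip: "sqnorm (flip f) = sqnorm f"
  unfolding sqnorm_def by (rule infsum_cong) (simp add: cmod_flip)

text \<open>The signs at the two ends of an edge multiply to \<open>-1\<close>.\<close>

lemma edge_form_flip: "edge_form (flip f) (flip f) = - edge_form f f"
proof -
  have "bipartition_sign (head G e) * cnj (bipartition_sign (head G e)) = 1" if "e \<in> arcs G" for e
    using edges_bipartite[OF that] by (auto simp: bipartition_sign_def)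
  then have "flip f (tail G e) * cnj (flip f (head G e)) = - (f (tail G e) * cnj (f (head G e)))"
    if "e \<in> arcs G" for e
    using that by (simp add: flip_def bipartition_sign_tail mult.assoc mult.left_commute)
  then show ?thesis
    unfolding edge_form_def infsum_uminus[symmetric] by (intro infsum_cong) simp
qed

lemma inner_flip_all_one: "inner_G (flip f) all_one = inner_G f bipartition_sign"
  unfolding L2_inner_def
  by (rule infsum_cong) (auto simp: flip_def all_one_def bipartition_sign_def)

lemma inner_flip_bipartition_sign: "inner_G (flip f) bipartition_sign = inner_G f all_one"
  unfolding L2_inner_def using bipartition
  by (intro infsum_cong) (auto simp: flip_def all_one_def bipartition_sign_def)

text \<open>For nonzero \<open>f\<close> in \<open>L2_0\<close>, also \<open>flip f\<close> lies in
  \<open>L2_0\<close>. Hence \<open>M\<close> times the squared norm bounds both a real number and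
  its negative.\<close>

lemma M_nonneg:
  assumes "L2_0 G wv Vo Vi \<noteq> {\<lambda>v. 0}"
  shows "diagM \<ge> 0"
proof -
  have "(\<lambda>v. 0) \<in> L2_0 G wv Vo Vi" by (simp add: L2_0_def L2_def)
  with assms obtain f where f0: "f \<in> L2_0 G wv Vo Vi" and ne: "f \<noteq> (\<lambda>v. 0)" by blast
  have f: "f \<in> L2 G wv" using f0 by (simp add: L2_0_def)
  have pos: "sqnorm f > 0"
    using sqnorm_eq_0[OF f] ne sqnorm_nonneg[of f] by fastforce
  have "flip f \<in> L2_0 G wv Vo Vi"
    using f0 unfolding L2_0_iff[OF f] L2_0_iff[OF L2_flip[OF f]]
    by (simp add: inner_flip_all_one inner_flip_bipartition_sign)
  from edge_form_le_M[OF this] edge_form_le_M[OF f0] have "0 \<le> diagM * sqnorm f"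
    by (simp add: edge_form_flip sqnorm_flip)
  then show ?thesis using pos by (simp add: zero_le_mult_iff)
qed

text \<open>A function orthogonal to the constants need not lie in \<^const>\<open>L2_0\<close>, but the component that has
  to be removed is an eigenfunction of the adjacency operator for the negative eigenvalue \<open>-(q + 1)\<close>.\<close>

lemma edge_form_le_M_of_orthogonal_all_one:
  assumes ne: "L2_0 G wv Vo Vi \<noteq> {\<lambda>v. 0}"
    and f: "f \<in> L2 G wv" and orth: "inner_G f all_one = 0"
  shows "Re (edge_form f f) \<le> diagM * sqnorm f"
proof -
  let ?h = bipartition_sign
  note h = L2_bipartition_sign
  define N where "N = sqnorm ?h"
  have hh: "inner_G ?h ?h = of_real N" unfolding N_def by (rule inner_self[OF h])
  \<comment> \<open>The coefficient of the orthogonal projection onto the bipartition sign. Should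
    \<open>N\<close> be 0, the sign function is zero and the projection identity reads
    \<open>0 = 0\<close>.\<close>
  define a where "a = inner_G f ?h / inner_G ?h ?h"
  have a: "inner_G f ?h = a * inner_G ?h ?h"
  proof (cases "N = 0")
    case True
    then have "?h = (\<lambda>v. 0)" using sqnorm_eq_0[OF h] by (auto simp: N_def)
    then have "inner_G f ?h = 0" by (simp add: L2_inner_def)
    then show ?thesis by (simp add: a_def)
  qed (simp add: a_def hh)
  define g where "g = (\<lambda>v. f v + (- a) * ?h v)"
  have ah: "(\<lambda>v. (- a) * ?h v) \<in> L2 G wv" and ah': "(\<lambda>v. a * ?h v) \<in> L2 G wv"
    by (intro L2_scale h)+
  have g: "g \<in> L2 G wv" unfolding g_def by (intro L2_add f ah)
  have gh: "inner_G g ?h = 0"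
    unfolding g_def inner_add_left[OF f ah h] inner_scale_left a by simp
  have "inner_G g all_one = 0"
    unfolding g_def inner_add_left[OF f ah L2_all_one] inner_scale_left
    by (simp add: orth inner_bipartition_sign_all_one)
  with gh g have g0: "g \<in> L2_0 G wv Vo Vi" by (simp add: L2_0_iff)
  have hg: "inner_G ?h g = 0" using arg_cong[OF gh, of cnj] by (simp add: cnj_inner)
  have f_eq: "f = (\<lambda>v. g v + a * ?h v)" by (simp add: g_def)
  have Bhg: "edge_form ?h g = 0" by (simp add: edge_form_bipartition_sign[OF g] hg)
  then have Bgh: "edge_form g ?h = 0"
    using cnj_edge_form[of ?h g] by simp
  have Bhh: "edge_form ?h ?h = - of_real ((real q + 1) * N)"
    by (simp add: edge_form_bipartition_sign[OF h] hh algebra_simps)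
  \<comment> \<open>The components \<open>g\<close> and \<open>a * ?h\<close> are orthogonal for the
    adjacency form as well as for the inner product, so both expansions lose their cross
    terms.\<close>
  have "edge_form f f = edge_form g g + a * cnj a * edge_form ?h ?h"
    unfolding f_eq using g h ah'
    by (simp add: edge_form_add_left edge_form_add_right L2_add edge_form_scale_left
        edge_form_scale_right Bhg Bgh)
  then have Bff: "Re (edge_form f f) = Re (edge_form g g) - (cmod a)\<^sup>2 * ((real q + 1) * N)"
    unfolding Bhh by (simp flip: complex_norm_square)
  have "inner_G f f = inner_G g g + a * cnj a * inner_G ?h ?h"
    unfolding f_eq using g h ah'
    by (simp add: inner_add_left inner_add_right L2_add inner_scale_left inner_scale_right gh hg)
  then have "complex_of_real (sqnorm f) = complex_of_real (sqnorm g + (cmod a)\<^sup>2 * N)"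
    by (simp add: inner_self f g hh flip: complex_norm_square)
  then have nf: "sqnorm f = sqnorm g + (cmod a)\<^sup>2 * N" by (simp only: of_real_eq_iff)
  have "N \<ge> 0" by (simp add: N_def sqnorm_nonneg)
  have "Re (edge_form f f) \<le> Re (edge_form g g)"
    using \<open>N \<ge> 0\<close> by (simp add: Bff)
  also have "\<dots> \<le> diagM * sqnorm g" by (rule edge_form_le_M[OF g0])
  \<comment> \<open>Passing from \<open>g\<close> to the larger norm of \<open>f\<close> rests on
    \<open>M\<close> being nonnegative, which is where \<open>L2_0\<close> being nonzero
    enters.\<close>
  also have "\<dots> \<le> diagM * sqnorm f"
    using M_nonneg[OF ne] \<open>N \<ge> 0\<close> by (intro mult_left_mono) (auto simp: nf)
  finally show ?thesis .
qed

text \<open>\<open>flip\<close> trades orthogonality to the sign for orthogonality to 1 and negates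
  the form.\<close>

lemma edge_form_ge_M_of_orthogonal_bipartition_sign:
  assumes ne: "L2_0 G wv Vo Vi \<noteq> {\<lambda>v. 0}"
    and f: "f \<in> L2 G wv" and orth: "inner_G f bipartition_sign = 0"
  shows "Re (edge_form f f) \<ge> - (diagM * sqnorm f)"
  using edge_form_le_M_of_orthogonal_all_one[OF ne L2_flip[OF f]] orth
  by (simp add: inner_flip_all_one edge_form_flip sqnorm_flip)

lemma edge_form_lower_bound:
  assumes "f \<in> L2 G wv"
  shows "Re (edge_form f f) \<ge> - ((real q + 1) * sqnorm f)"
  using edge_form_bound[OF L2_flip[OF assms]] by (simp add: edge_form_flip sqnorm_flip)

end

section \<open>The Laplacian of a finite induced subgraph\<close>

context regular_diagram
begin

text \<open>Support in \<open>A\<close> is asked of one argument only, because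
  \<open>adj_G f\<close> may spread to vertices outside \<open>A\<close>.\<close>

lemma inner_eq_fin_inner:
  assumes A: "finite A" "A \<subseteq> verts G" and "(\<forall>u. u \<notin> A \<longrightarrow> f u = 0) \<or> (\<forall>u. u \<notin> A \<longrightarrow> g u = 0)"
  shows "inner_G f g = fin_inner A wv f g"
proof -
  have "inner_G f g = (\<Sum>\<^sub>\<infinity>v\<in>A. f v * cnj (g v) / of_nat (wv v))"
    unfolding L2_inner_def using assms by (intro infsum_cong_neutral) auto
  then show ?thesis using A(1) by (simp add: fin_inner_def)
qed

context
  fixes H :: "('v, 'e) pre_digraph"
  assumes H: "induced_subgraph H G" and fin: "finite (verts H)"
begin

lemma verts_H: "verts H \<subseteq> verts G"
  using H by (auto simp: induced_subgraph_def subgraph_def)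

text \<open>Inducedness enters here: a vertex of \<open>H\<close> loses exactly the edges that start
  outside \<open>H\<close>.\<close>

lemma in_arcs_H: "v \<in> verts H \<Longrightarrow> in_arcs H v = {e \<in> in_arcs G v. tail G e \<in> verts H}"
  using H by (auto simp: induced_subgraph_def subgraph_def compatible_def in_arcs_def)

lemma tail_H: "tail H = tail G"
  using H by (simp add: induced_subgraph_def subgraph_def compatible_def)

lemma weighted_degree_H_le:
  assumes v: "v \<in> verts H"
  shows "weighted_degree H we wv v \<le> real q + 1"
proof -
  have "weighted_degree H we wv v \<le> weighted_degree G we wv v"
    unfolding weighted_degree_def in_arcs_H[OF v] using v verts_H
    by (intro sum_mono2 locally_finite) auto
  then show ?thesis using regular v verts_H by auto
qed

text \<open>Edges starting outside \<open>H\<close> contribute nothing to \<open>adj_G f\<close>, as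
  \<open>f\<close> vanishes at their tails; only the degree has to be taken in
  \<open>H\<close>.\<close>

lemma weighted_laplacian_H:
  assumes "\<forall>u. u \<notin> verts H \<longrightarrow> f u = 0" and v: "v \<in> verts H"
  shows "weighted_laplacian H we wv f v = of_real (weighted_degree H we wv v) * f v - adj_G f v"
proof -
  have "adj_G f v = (\<Sum>e\<in>in_arcs H v. of_nat (wv v) / of_nat (we e) * f (tail G e))"
    unfolding adjacency_def using assms verts_H locally_finite
    by (intro sum.mono_neutral_right) (auto simp: in_arcs_H)
  then show ?thesis
    unfolding weighted_laplacian_def weighted_degree_def tail_H
    by (simp add: sum_distrib_right sum_subtractf right_diff_distrib)
qed

lemma fin_inner_laplacian:
  assumes f: "\<forall>u. u \<notin> verts H \<longrightarrow> f u = 0" and g: "\<forall>u. u \<notin> verts H \<longrightarrow> g u = 0"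
  shows "fin_inner (verts H) wv (weighted_laplacian H we wv f) g
    = (\<Sum>v\<in>verts H. of_real (weighted_degree H we wv v) * (f v * cnj (g v) / of_nat (wv v)))
      - edge_form f g"
proof -
  have L2: "f \<in> L2 G wv" "g \<in> L2 G wv"
    using f g by (auto intro!: L2_finite_support[OF fin verts_H])
  have "edge_form f g = fin_inner (verts H) wv (adj_G f) g"
    using inner_eq_fin_inner[OF fin verts_H] g inner_adjacency[OF L2] by simp
  then show ?thesis
    unfolding fin_inner_def
    by (simp add: weighted_laplacian_H[OF f] left_diff_distrib diff_divide_distrib sum_subtractf
        mult.assoc)
qed

text \<open>The degree part is diagonal with real entries, and the edge part is Hermitian by edge
  reversal.\<close>

lemma laplacian_self_adjoint:
  assumes f: "\<forall>u. u \<notin> verts H \<longrightarrow> f u = 0" and g: "\<forall>u. u \<notin> verts H \<longrightarrow> g u = 0"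
  shows "fin_inner (verts H) wv (weighted_laplacian H we wv f) g
    = fin_inner (verts H) wv f (weighted_laplacian H we wv g)"
proof -
  have "fin_inner (verts H) wv f (weighted_laplacian H we wv g)
      = cnj (fin_inner (verts H) wv (weighted_laplacian H we wv g) f)"
    by (simp add: cnj_fin_inner)
  then show ?thesis
    unfolding fin_inner_laplacian[OF f g] fin_inner_laplacian[OF g f]
    by (simp add: cnj_edge_form mult.commute)
qed

lemma laplacian_coordinates:
  "\<forall>f. (\<forall>u. u \<notin> verts H \<longrightarrow> f u = 0) \<longrightarrow> (\<forall>v\<in>verts H. weighted_laplacian H we wv f v
    = (\<Sum>u\<in>verts H. f u * weighted_laplacian H we wv (\<lambda>x. if x = u then 1 else 0) v))"
proof (intro allI impI ballI)
  fix f :: "'v \<Rightarrow> complex" and v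
  assume f: "\<forall>u. u \<notin> verts H \<longrightarrow> f u = 0"
  have coord: "(\<Sum>u\<in>verts H. f u * (if x = u then 1 else 0)) = f x" for x
    using f fin by (simp add: if_distrib cong: if_cong)
  have "(\<Sum>u\<in>verts H. f u * weighted_laplacian H we wv (\<lambda>x. if x = u then 1 else 0) v)
      = (\<Sum>e\<in>in_arcs H v. of_nat (wv v) / of_nat (we e) *
          ((\<Sum>u\<in>verts H. f u * (if v = u then 1 else 0))
            - (\<Sum>u\<in>verts H. f u * (if tail H e = u then 1 else 0))))"
    unfolding weighted_laplacian_def sum_distrib_left sum_subtractf[symmetric] right_diff_distrib
    by (subst sum.swap) (simp add: mult.left_commute)
  then show "weighted_laplacian H we wv f v
      = (\<Sum>u\<in>verts H. f u * weighted_laplacian H we wv (\<lambda>x. if x = u then 1 else 0) v)"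
    unfolding coord by (simp add: weighted_laplacian_def)
qed

lemma sqnorm_eq_fin_inner:
  assumes "\<forall>u. u \<notin> verts H \<longrightarrow> f u = 0"
  shows "sqnorm f = Re (fin_inner (verts H) wv f f)"
proof -
  have "f \<in> L2 G wv" using assms by (intro L2_finite_support[OF fin verts_H]) auto
  then show ?thesis
    using inner_self[of f] inner_eq_fin_inner[OF fin verts_H, of f f] assms by simp
qed

lemma rayleigh_laplacian:
  assumes f: "\<forall>u. u \<notin> verts H \<longrightarrow> f u = 0"
  shows "Re (fin_inner (verts H) wv (weighted_laplacian H we wv f) f)
    = (\<Sum>v\<in>verts H. weighted_degree H we wv v * ((cmod (f v))\<^sup>2 / real (wv v))) - Re (edge_form f f)"
proof -
  have "of_real (weighted_degree H we wv v) * (f v * cnj (f v) / of_nat (wv v))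
      = complex_of_real (weighted_degree H we wv v * ((cmod (f v))\<^sup>2 / real (wv v)))" for v
    by (simp add: complex_norm_square del: of_real_power)
  then show ?thesis
    unfolding fin_inner_laplacian[OF f f] by (simp only: minus_complex.sel Re_complex_of_real flip: of_real_sum)
qed

text \<open>Degrees in \<open>H\<close> are at most \<open>q + 1\<close>; the adjacency form is
  kept, to be estimated according to what \<open>f\<close> is orthogonal to.\<close>

lemma rayleigh_laplacian_le:
  assumes f: "\<forall>u. u \<notin> verts H \<longrightarrow> f u = 0"
  shows "Re (fin_inner (verts H) wv (weighted_laplacian H we wv f) f)
    \<le> (real q + 1) * sqnorm f - Re (edge_form f f)"
  unfolding rayleigh_laplacian[OF f] sqnorm_eq_fin_inner[OF f] fin_inner_self Re_complex_of_real
    sum_distrib_left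
  by (intro diff_right_mono sum_mono mult_right_mono weighted_degree_H_le) auto

lemma rayleigh_laplacian_ge:
  assumes f: "\<forall>u. u \<notin> verts H \<longrightarrow> f u = 0"
  shows "Re (fin_inner (verts H) wv (weighted_laplacian H we wv f) f)
    \<ge> Min (weighted_degree H we wv ` verts H) * sqnorm f - Re (edge_form f f)"
  unfolding rayleigh_laplacian[OF f] sqnorm_eq_fin_inner[OF f] fin_inner_self Re_complex_of_real
    sum_distrib_left
  using fin by (intro diff_right_mono sum_mono mult_right_mono) auto

end

end

text \<open>Moves two chosen eigenvalues to the front, where the Schur decomposition provides an
  invariant plane for them.\<close>

lemma prod_two_first:
  assumes "finite A" "i \<in> A" "j \<in> A" "i \<noteq> j"
  obtains es where "(\<Prod>k\<in>A. [:- complex_of_real (\<gamma> k), 1:])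
    = (\<Prod>c\<leftarrow>complex_of_real (\<gamma> i) # complex_of_real (\<gamma> j) # es. [:- c, 1:])"
proof -
  obtain ks where ks: "set ks = A - {i, j}" "distinct ks"
    using finite_distinct_list assms(1) by (metis finite_Diff)
  have "A = set (i # j # ks)" "distinct (i # j # ks)" using assms ks by auto
  then have "(\<Prod>k\<in>A. [:- complex_of_real (\<gamma> k), 1:])
      = (\<Prod>k\<leftarrow>i # j # ks. [:- complex_of_real (\<gamma> k), 1:])"
    by (metis prod.distinct_set_conv_list)
  also have "\<dots> = (\<Prod>c\<leftarrow>complex_of_real (\<gamma> i) # complex_of_real (\<gamma> j)
      # map (\<lambda>k. complex_of_real (\<gamma> k)) ks. [:- c, 1:])"
    by (simp add: o_def)
  finally show ?thesis by (rule that)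
qed

section \<open>The three eigenvalue bounds\<close>

theorem theorem3p10:
  fixes G H :: "('v, 'e) pre_digraph" and arev :: "'e \<Rightarrow> 'e"
    and we :: "'e \<Rightarrow> nat" and wv :: "'v \<Rightarrow> nat" and Vo Vi :: "'v set"
    and q n :: nat and M d1 :: real and \<gamma> :: "nat \<Rightarrow> real"
  assumes "regular_diagram G arev we wv Vo Vi q"
    and "L2_0 G wv Vo Vi \<noteq> {\<lambda>v. 0}"
    and "induced_subgraph H G"
    and "finite (verts H)"
    and "Digraph_Component.connected H"
    and "n = card (verts H)" and "n \<ge> 2"
    and "M = diagram_M G we wv Vo Vi"
    and "d1 = Min (weighted_degree H we wv ` verts H)"
    and "ordered_eigenvalues (verts H) (weighted_laplacian H we wv) \<gamma>"
  shows "\<gamma> 2 \<ge> d1 - M \<and> \<gamma> (n - 1) \<le> (real q + 1) + M \<and> \<gamma> n \<le> 2 * (real q + 1)"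
proof -
  interpret D: regular_diagram G arev we wv Vo Vi q by (rule assms(1))
  note H = assms(3,4)
  let ?A = "verts H" and ?T = "weighted_laplacian H we wv"
  note sub = D.verts_H[OF H]
  have w: "\<forall>v\<in>?A. wv v > 0" using sub D.vertex_weight_pos by blast
  have mono: "mono_on {1..n} \<gamma>" using assms(6,10) by (simp add: ordered_eigenvalues_def)
  obtain vs where vs: "distinct vs" "set vs = ?A"
    and cp: "char_poly (operator_mat vs ?T) = (\<Prod>i = 1..n. [:- complex_of_real (\<gamma> i), 1:])"
    using assms(6,10) unfolding ordered_eigenvalues_def by blast
  note lin = D.laplacian_coordinates[OF H] and sa = D.laplacian_self_adjoint[OF H]
  have L2: "f \<in> L2 G wv" if "\<forall>u. u \<notin> ?A \<longrightarrow> f u = 0" for f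
    using that by (intro D.L2_finite_support[OF assms(4) sub]) auto
  note inner = D.inner_eq_fin_inner[OF assms(4) sub]
  note norm = D.sqnorm_eq_fin_inner[OF H]
  have "\<gamma> 2 \<ge> d1 - M"
  proof -
    obtain es where "(\<Prod>k = 1..n. [:- complex_of_real (\<gamma> k), 1:])
        = (\<Prod>c\<leftarrow>complex_of_real (\<gamma> 1) # complex_of_real (\<gamma> 2) # es. [:- c, 1:])"
      using \<open>n \<ge> 2\<close> by (rule_tac prod_two_first[of "{1..n}" 1 2 \<gamma>]) auto
    note cp' = cp[unfolded this]
    show ?thesis
    proof (rule rayleigh_quotient_between[where T = ?T and k = D.all_one, OF vs cp' w lin sa])
      fix f
      assume f: "\<forall>u. u \<notin> ?A \<longrightarrow> f u = 0" and pos: "0 < Re (fin_inner ?A wv f f)"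
        and orth: "fin_inner ?A wv f D.all_one = 0"
        and le: "Re (fin_inner ?A wv (?T f) f) \<le> max (\<gamma> 1) (\<gamma> 2) * Re (fin_inner ?A wv f f)"
      have "\<gamma> 1 \<le> \<gamma> 2" using mono \<open>n \<ge> 2\<close> by (auto intro: mono_onD)
      then have "Re (fin_inner ?A wv (?T f) f) \<le> \<gamma> 2 * D.sqnorm f"
        using le by (simp add: norm[OF f])
      moreover have "Re (D.edge_form f f) \<le> M * D.sqnorm f"
        using D.edge_form_le_M_of_orthogonal_all_one[OF assms(2) L2[OF f]] f orth inner
        by (simp add: assms(8))
      \<comment> \<open>The Rayleigh quotient is squeezed: degrees and \<open>M\<close> bound it
        below by \<open>d1 - M\<close>, the plane of the two lowest eigenvalues bounds it above by
        \<open>\<gamma> 2\<close>.\<close>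
      ultimately have "(d1 - M) * D.sqnorm f \<le> \<gamma> 2 * D.sqnorm f"
        using D.rayleigh_laplacian_ge[OF H f] by (simp add: assms(9) left_diff_distrib)
      then show ?thesis using pos by (simp add: norm[OF f])
    qed
  qed
  \<comment> \<open>From \<open>n \<ge> 2\<close>, the index \<open>n - 1\<close> lies in
    \<open>{1..n}\<close> and differs from \<open>n\<close>. With \<open>\<gamma> n\<close> in
    front, the same factorization also gives an eigenfunction for the third bound.\<close>
  moreover obtain es where last: "(\<Prod>k = 1..n. [:- complex_of_real (\<gamma> k), 1:])
        = (\<Prod>c\<leftarrow>complex_of_real (\<gamma> n) # complex_of_real (\<gamma> (n - 1)) # es. [:- c, 1:])"
    using \<open>n \<ge> 2\<close> by (rule_tac prod_two_first[of "{1..n}" n "n - 1" \<gamma>]) auto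
  note cp' = cp[unfolded last]
  have "\<gamma> (n - 1) \<le> (real q + 1) + M"
  proof (rule rayleigh_quotient_between[where T = ?T and k = D.bipartition_sign, OF vs cp' w lin sa])
    fix f
    assume f: "\<forall>u. u \<notin> ?A \<longrightarrow> f u = 0" and pos: "0 < Re (fin_inner ?A wv f f)"
      and orth: "fin_inner ?A wv f D.bipartition_sign = 0"
      and le: "min (\<gamma> n) (\<gamma> (n - 1)) * Re (fin_inner ?A wv f f) \<le> Re (fin_inner ?A wv (?T f) f)"
    have "\<gamma> (n - 1) \<le> \<gamma> n" using mono \<open>n \<ge> 2\<close> by (auto intro: mono_onD)
    then have "\<gamma> (n - 1) * D.sqnorm f \<le> Re (fin_inner ?A wv (?T f) f)"
      using le by (simp add: norm[OF f] min_def split: if_splits)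
    moreover have "Re (D.edge_form f f) \<ge> - (M * D.sqnorm f)"
      using D.edge_form_ge_M_of_orthogonal_bipartition_sign[OF assms(2) L2[OF f]] f orth inner
      by (simp add: assms(8))
    ultimately have "\<gamma> (n - 1) * D.sqnorm f \<le> (real q + 1 + M) * D.sqnorm f"
      using D.rayleigh_laplacian_le[OF H f] by (simp add: distrib_right)
    then show ?thesis using pos by (simp add: norm[OF f])
  qed
  moreover have "\<gamma> n \<le> 2 * (real q + 1)"
  proof (rule orthogonal_eigenfunctions[where T = ?T, OF vs cp' w lin sa])
    fix f
    assume f: "\<forall>u. u \<notin> ?A \<longrightarrow> f u = 0" and ne: "\<exists>v\<in>?A. f v \<noteq> 0"
      and Tf: "\<And>v. v \<in> ?A \<Longrightarrow> ?T f v = complex_of_real (\<gamma> n) * f v"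
    have "fin_inner ?A wv (?T f) f = fin_inner ?A wv (\<lambda>v. complex_of_real (\<gamma> n) * f v) f"
      by (rule fin_inner_cong) (auto simp: Tf)
    then have "Re (fin_inner ?A wv (?T f) f) = \<gamma> n * D.sqnorm f"
      by (simp add: fin_inner_simps norm[OF f])
    \<comment> \<open>One summand \<open>q + 1\<close> comes from the degrees, the other from the
      lower bound of the adjacency form.\<close>
    then have "\<gamma> n * D.sqnorm f \<le> 2 * (real q + 1) * D.sqnorm f"
      using D.rayleigh_laplacian_le[OF H f] D.edge_form_lower_bound[OF L2[OF f]]
      by (simp add: algebra_simps)
    moreover have "D.sqnorm f > 0"
      using ne w assms(4) unfolding norm[OF f] by (metis fin_inner_self_pos)
    ultimately show ?thesis by simp
  qed
  ultimately show ?thesis by blast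
qed

end
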